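(* Let $q\in(0,1)$, $s=1-q$. Under memoryless catastrophe with rate $q$, the probability generating function $G_T(w)=E[w^T]$ of the completion time satisfies, for every positive-integer-valued almost surely finite base time $T_0$ with probability generating function $g$, \[ G_T(w)=\frac{a(w)\,g(u(w))+b(w)}{c(w)\,g(u(w))+d(w)}, \] where \[ a(w)=1-ws,\quad b(w)=0,\quad c(w)=qw,\quad d(w)=1-w,\quad u(w)=ws, \] and with these functions memoryless catastrophe has uniform affine PGF structure. Moreover $b(1)=0=d(1)$, and the normalization $G_T(1)=1$ forces \[ a(1)=q=c(1). \]
   Context: Memoryless catastrophe with rate $q$: at each step, independently of everything else, a catastrophe occurs with probability $q$; if it occurs before the base task has completed, all progress is destroyed and the process restarts from scratch with a fresh independent copy of $T_0$; the process terminates at the first step at which no catastrophe occurs and the base task completes. Formally, attempts $i=1,2,\dots$ are independent; attempt $i$ has a copy $T_0^{(i)}$ of $T_0$ and an independent $\tau_i$ with $P(\tau_i>t)=s^t$, $t=0,1,2,\dots$; it succeeds iff $T_0^{(i)}<\tau_i$, and lasts $\min(T_0^{(i)},\tau_i)$ steps. The completion time $T$ is the total length of all attempts up to and including the first successful one. The success probability of an attempt is $p=g(s)>0$. $g(z)=E[z^{T_0}]$. Uniform affine PGF structure (of a catastrophe mechanism): there exist functions $a(w),b(w),c(w),d(w)$, analytic in a neighborhood of $w=1$, depending only on the mechanism (not on $T_0$), and a linear function $u(w)$ with $u(1)\in(0,1)$, such that for all base times $T_0$ one has $G_T(w)=\dfrac{a(w)g(u(w))+b(w)}{c(w)g(u(w))+d(w)}$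 (for $w$ near $1$, $|w|\le1$), with $a$ and $c$ not identically zero, and $c(1)g(u(1))+d(1)\ne0$ for all admissible $g$ (all PGFs of base times). *)

theory Defs
  imports "HOL-Probability.Probability" "HOL-Complex_Analysis.Complex_Analysis"
begin

section \<open>Probability generating functions\<close>

text \<open>Times may be infinite; as usual for generating functions, the event \<open>T = \<infinity>\<close>
  contributes nothing to \<open>E[w^T]\<close>, also at \<open>w = 1\<close>.  So \<open>pgf M T 1 = P(T < \<infinity>)\<close>.\<close>

definition enat_power :: "complex \<Rightarrow> enat \<Rightarrow> complex" where
  "enat_power w n = (case n of enat k \<Rightarrow> w ^ k | \<infinity> \<Rightarrow> 0)"

definition pgf :: "'a measure \<Rightarrow> ('a \<Rightarrow> enat) \<Rightarrow> complex \<Rightarrow> complex" where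
  "pgf M T w = (\<integral>\<omega>. enat_power w (T \<omega>) \<partial>M)"

section \<open>Base times\<close>

text \<open>A base time is represented by its law; almost sure finiteness is
  built into \<^typ>\<open>nat pmf\<close>.\<close>

definition base_time :: "nat pmf \<Rightarrow> bool" where
  "base_time p \<longleftrightarrow> 0 \<notin> set_pmf p"

definition base_pgf :: "nat pmf \<Rightarrow> complex \<Rightarrow> complex" where
  "base_pgf p = pgf (measure_pmf p) enat"

section \<open>Memoryless catastrophe\<close>

text \<open>\<open>x i\<close> is the base time and \<open>t i\<close> the catastrophe time of attempt \<open>i\<close>.\<close>

definition completion_time :: "(nat \<Rightarrow> nat) \<Rightarrow> (nat \<Rightarrow> nat) \<Rightarrow> enat" where
  "completion_time x t =
     (if \<exists>i. x i < t i
      then enat (\<Sum>j\<le>(LEAST i. x i < t i). min (x j) (t j))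
      else \<infinity>)"

locale memoryless_catastrophe = prob_space M for M :: "'a measure" +
  fixes q :: real and p :: "nat pmf"
    and X :: "nat \<Rightarrow> 'a \<Rightarrow> nat" and \<tau> :: "nat \<Rightarrow> 'a \<Rightarrow> nat"
  assumes base: "base_time p"
    and X_measurable: "\<And>i. random_variable (count_space UNIV) (X i)"
    and \<tau>_measurable: "\<And>i. random_variable (count_space UNIV) (\<tau> i)"
    and X_law: "\<And>i. distr M (count_space UNIV) (X i) = measure_pmf p"
    and \<tau>_tail: "\<And>i t. prob {\<omega> \<in> space M. t < \<tau> i \<omega>} = (1 - q) ^ t"
    and attempts_indep:
      "indep_vars (\<lambda>_. count_space UNIV) (\<lambda>i \<omega>. (X i \<omega>, \<tau> i \<omega>)) UNIV"
    and X_\<tau>_indep: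
      "\<And>i. indep_var (count_space UNIV) (X i) (count_space UNIV) (\<tau> i)"

text \<open>The law of the completion time as a function of the law of the base time, realised
  on the canonical product space.  The shift of \<^const>\<open>geometric_pmf\<close>, which counts
  from 0, gives \<open>P(\<tau> > t) = (1 - q)^t\<close>.\<close>

definition memoryless_law :: "real \<Rightarrow> nat pmf \<Rightarrow> enat measure" where
  "memoryless_law q p =
     distr (\<Pi>\<^sub>M i\<in>(UNIV :: nat set).
              measure_pmf (pair_pmf p (map_pmf Suc (geometric_pmf q))))
       (count_space UNIV)
       (\<lambda>\<omega>. completion_time (\<lambda>i. fst (\<omega> i)) (\<lambda>i. snd (\<omega> i)))"

section \<open>Uniform affine PGF structure\<close>

text \<open>A mechanism maps the law of a base time to the law of the resulting completion time.
  The coefficients are only constrained near 1, so ``not identically zero'' is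
  required in every neighbourhood of 1.\<close>

definition uniform_affine_pgf ::
  "(nat pmf \<Rightarrow> enat measure) \<Rightarrow> (complex \<Rightarrow> complex) \<Rightarrow> (complex \<Rightarrow> complex) \<Rightarrow>
   (complex \<Rightarrow> complex) \<Rightarrow> (complex \<Rightarrow> complex) \<Rightarrow> (complex \<Rightarrow> complex) \<Rightarrow> bool" where
  "uniform_affine_pgf mech a b c d u \<longleftrightarrow>
     a analytic_on {1} \<and> b analytic_on {1} \<and> c analytic_on {1} \<and> d analytic_on {1} \<and>
     \<not> (\<forall>\<^sub>F w in nhds 1. a w = 0) \<and> \<not> (\<forall>\<^sub>F w in nhds 1. c w = 0) \<and>
     (\<exists>r::real. 0 < r \<and> r < 1 \<and> (\<forall>w. u w = of_real r * w)) \<and>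
     (\<forall>p. base_time p \<longrightarrow>
        c 1 * base_pgf p (u 1) + d 1 \<noteq> 0 \<and>
        (\<forall>\<^sub>F w in nhds 1. norm w \<le> 1 \<longrightarrow>
           pgf (mech p) (\<lambda>n. n) w =
             (a w * base_pgf p (u w) + b w) / (c w * base_pgf p (u w) + d w)))"

end

theory Submission
  imports Defs
begin

text \<open>Split \<open>E[w^T]\<close> according to the number of failed attempts.  By independence this is the
  geometric series \<open>\<Sum>i. B^i * A\<close>, where \<open>A = E[w^T\<^sub>0; T\<^sub>0 < \<tau>] = g(ws)\<close> and
  \<open>B = E[w^\<tau>; \<tau> \<le> T\<^sub>0]\<close> are the contributions of one successful and one failed attempt.
  Summing over \<open>\<tau>\<close> for fixed \<open>T\<^sub>0\<close> gives \<open>(1 - ws) * B = qw * (1 - g(ws))\<close>, so that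
  \<open>A / (1 - B)\<close> is the claimed quotient.\<close>

section \<open>Products of discrete laws\<close>

text \<open>Countability makes the product sigma-algebra the full power set, so comparing singletons
  suffices. This opens Fubini for \<open>pair_pmf\<close>, and later identifies the joint law of an
  independent pair.\<close>

lemma pair_measure_pmf:
  fixes p :: "'a::countable pmf" and r :: "'b::countable pmf"
  shows "measure_pmf p \<Otimes>\<^sub>M measure_pmf r = measure_pmf (pair_pmf p r)"
proof (rule measure_eqI_countable)
  have "sets (measure_pmf p \<Otimes>\<^sub>M measure_pmf r) =
      sets (count_space (UNIV :: 'a set) \<Otimes>\<^sub>M count_space (UNIV :: 'b set))"
    by (intro sets_pair_measure_cong) auto
  also have "\<dots> = Pow (UNIV \<times> UNIV)"
    by (subst pair_measure_countable) auto
  finally show "sets (measure_pmf p \<Otimes>\<^sub>M measure_pmf r) = Pow UNIV" by simp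
  fix z :: "'a \<times> 'b"
  obtain x y where z: "z = (x, y)" by fastforce
  have "emeasure (measure_pmf p \<Otimes>\<^sub>M measure_pmf r) ({x} \<times> {y}) =
      emeasure (measure_pmf p) {x} * emeasure (measure_pmf r) {y}"
    by (rule measure_pmf.emeasure_pair_measure_Times) auto
  then show "emeasure (measure_pmf p \<Otimes>\<^sub>M measure_pmf r) {z} =
      emeasure (measure_pmf (pair_pmf p r)) {z}"
    by (simp add: z emeasure_pmf_single pmf_pair ennreal_mult)
qed auto

lemma integral_pair_pmf:
  fixes p :: "'a::countable pmf" and r :: "'b::countable pmf"
    and f :: "'a \<times> 'b \<Rightarrow> 'c::{banach, second_countable_topology}"
  assumes "integrable (measure_pmf (pair_pmf p r)) f"
  shows "(\<integral>z. f z \<partial>pair_pmf p r) = (\<integral>x. \<integral>y. f (x, y) \<partial>r \<partial>p)"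
proof -
  interpret pair_sigma_finite "measure_pmf p" "measure_pmf r" ..
  show ?thesis
    using integral_fst'[of f] assms by (simp add: pair_measure_pmf)
qed

section \<open>Independent attempts and the pathwise expansion of \<open>w^T\<close>\<close>

text \<open>Expectation is multiplicative over independent bounded factors. The general field allows
  two uses: complex weights give the terms of the series, and their real norms give its absolute
  convergence.\<close>

lemma (in prob_space) indep_vars_integral_geometric:
  fixes Y :: "nat \<Rightarrow> 'a \<Rightarrow> 'b" and f h :: "'b \<Rightarrow> 'c::{real_normed_field, banach, second_countable_topology}"
  assumes indep: "indep_vars (\<lambda>_. count_space UNIV) Y UNIV"
    and law: "\<And>i. distr M (count_space UNIV) (Y i) = measure_pmf P"
    and f: "\<And>z. norm (f z) \<le> 1" and h: "\<And>z. norm (h z) \<le> 1"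
  shows "integrable M (\<lambda>\<omega>. (\<Prod>j<i. f (Y j \<omega>)) * h (Y i \<omega>))" (is ?int)
    and "(\<integral>\<omega>. (\<Prod>j<i. f (Y j \<omega>)) * h (Y i \<omega>) \<partial>M) = (\<integral>z. f z \<partial>P) ^ i * (\<integral>z. h z \<partial>P)" (is ?eq)
proof -
  have rv[measurable]: "Y j \<in> M \<rightarrow>\<^sub>M count_space UNIV" for j
    using indep by (auto simp: indep_vars_def)
  \<comment> \<open>A single indexed family over \<open>{..i}\<close> covers the \<open>i\<close>
    failures and the final success.\<close>
  define k where "k j = (if j < i then f else h)" for j
  have k: "norm (k j z) \<le> 1" for j z
    using f h by (auto simp: k_def)
  have int: "integrable M (\<lambda>\<omega>. k j (Y j \<omega>))" for j
    by (rule integrable_const_bound[where B=1]) (auto simp: k intro: measurable_compose[OF rv])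
  have ind: "indep_vars (\<lambda>_. borel) (\<lambda>j \<omega>. k j (Y j \<omega>)) {..i}"
    by (rule indep_vars_subset[OF indep_vars_compose2[OF indep]]) auto
  have prod: "(\<Prod>j\<le>i. k j (z j)) = (\<Prod>j<i. f (z j)) * h (z i)" for z
    by (simp add: k_def flip: lessThan_Suc_atMost)
  have law_k: "(\<integral>\<omega>. k j (Y j \<omega>) \<partial>M) = (\<integral>z. k j z \<partial>P)" for j
    by (subst law[of j, symmetric], subst integral_distr) auto
  show ?int
    using indep_vars_integrable[OF _ ind int] by (simp add: prod)
  show ?eq
    using indep_vars_lebesgue_integral[OF _ ind int]
    by (simp add: prod law_k) (simp add: k_def flip: lessThan_Suc_atMost)
qed

text \<open>The \<open>i\<close>-th product describes \<open>i\<close> failures followed by a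
  success, which happens only when \<open>i\<close> is the index of the first success. If there is
  no success, all products and the power of infinity are 0, so any \<open>N\<close> serves.\<close>

lemma enat_power_completion_time:
  obtains N where
    "\<And>i. i \<noteq> N \<Longrightarrow> (\<Prod>j<i. if x j < t j then 0 else w ^ t j) * (if x i < t i then w ^ x i else 0) = 0"
    "enat_power w (completion_time x t) =
       (\<Prod>j<N. if x j < t j then 0 else w ^ t j) * (if x N < t N then w ^ x N else 0)"
proof (cases "\<exists>i. x i < t i")
  case True
  define N where "N = (LEAST i. x i < t i)"
  have N: "x N < t N"
    unfolding N_def using True by (rule LeastI_ex)
  have before: "\<not> x i < t i" if "i < N" for i
    using that not_less_Least unfolding N_def by blast
  show ?thesis
  proof (rule that[of N])
    show "(\<Prod>j<i. if x j < t j then 0 else w ^ t j) * (if x i < t i then w ^ x i else 0) = 0"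
      if "i \<noteq> N" for i
    proof (cases "i < N")
      case False
      \<comment> \<open>Beyond the first success, the factor at \<open>N\<close> is already
        0.\<close>
      then have "N \<in> {..<i}" using that by auto
      then show ?thesis
        using N by (auto intro!: prod_zero)
    qed (use before in simp)
    have "(\<Prod>j<N. if x j < t j then 0 else w ^ t j) = (\<Prod>j<N. w ^ min (x j) (t j))"
      using before by (intro prod.cong) (auto simp: min_def le_less)
    then show "enat_power w (completion_time x t) =
       (\<Prod>j<N. if x j < t j then 0 else w ^ t j) * (if x N < t N then w ^ x N else 0)"
      using True N
      by (simp add: enat_power_def completion_time_def power_add power_sum flip: N_def lessThan_Suc_atMost)
  qed
qed (auto intro: that simp: enat_power_def completion_time_def)

lemma completion_time_measurable [measurable]:
  fixes Y :: "nat \<Rightarrow> 'a \<Rightarrow> nat \<times> nat"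
  assumes Y[measurable]: "\<And>i. Y i \<in> M \<rightarrow>\<^sub>M count_space UNIV"
  shows "(\<lambda>\<omega>. completion_time (\<lambda>i. fst (Y i \<omega>)) (\<lambda>i. snd (Y i \<omega>))) \<in> M \<rightarrow>\<^sub>M count_space UNIV"
proof -
  have [measurable]: "(\<lambda>\<omega>. g (Y i \<omega>)) \<in> M \<rightarrow>\<^sub>M count_space UNIV" for g :: "_ \<Rightarrow> 'b" and i
    by (rule measurable_compose[OF Y]) simp
  have [measurable]: "Measurable.pred M (\<lambda>\<omega>. fst (Y i \<omega>) < snd (Y i \<omega>))" for i
    by (rule measurable_compose[OF Y]) simp
  \<comment> \<open>The upper summation bound is random: measurability is shown for each fixed bound
    \<open>n\<close>, then the countably many values of the first-success index are glued
    together.\<close>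
  have "(\<lambda>\<omega>. enat (\<Sum>j\<le>n. min (fst (Y j \<omega>)) (snd (Y j \<omega>)))) \<in> M \<rightarrow>\<^sub>M count_space UNIV" for n
    by measurable
  then have [measurable]: "(\<lambda>\<omega>. enat (\<Sum>j\<le>(LEAST i. fst (Y i \<omega>) < snd (Y i \<omega>)).
      min (fst (Y j \<omega>)) (snd (Y j \<omega>)))) \<in> M \<rightarrow>\<^sub>M count_space UNIV"
    by (rule measurable_compose_countable) measurable
  show ?thesis
    unfolding completion_time_def by measurable
qed

section \<open>The geometric series over the number of failures\<close>

text \<open>Integrating the pathwise expansion termwise yields \<open>B ^ i * A\<close>. A positive
  success probability keeps the ratio below 1 in norm, even at \<open>norm w = 1\<close>. Only the
  joint law \<open>P\<close> of a single attempt enters.\<close>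

lemma (in prob_space) pgf_completion_time:
  fixes Y :: "nat \<Rightarrow> 'a \<Rightarrow> nat \<times> nat" and w :: complex
  assumes indep: "indep_vars (\<lambda>_. count_space UNIV) Y UNIV"
    and law: "\<And>i. distr M (count_space UNIV) (Y i) = measure_pmf P"
    and w: "norm w \<le> 1"
    and succ: "measure_pmf.prob P {z. fst z < snd z} > 0"
  defines "A \<equiv> \<integral>z. (if fst z < snd z then w ^ fst z else 0) \<partial>P"
    and "B \<equiv> \<integral>z. (if fst z < snd z then 0 else w ^ snd z) \<partial>P"
  shows "norm B < 1"
    and "pgf M (\<lambda>\<omega>. completion_time (\<lambda>i. fst (Y i \<omega>)) (\<lambda>i. snd (Y i \<omega>))) w = A / (1 - B)"
proof -
  define f :: "nat \<times> nat \<Rightarrow> complex" where "f z = (if fst z < snd z then 0 else w ^ snd z)" for z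
  define h :: "nat \<times> nat \<Rightarrow> complex" where "h z = (if fst z < snd z then w ^ fst z else 0)" for z
  \<comment> \<open>\<open>r\<close> is the ratio of the series of integrated norms. It is at most
    the failure probability and dominates \<open>norm B\<close>.\<close>
  define r where "r = (\<integral>z. norm (f z) \<partial>P)"
  have f1: "norm (f z) \<le> 1" and h1: "norm (h z) \<le> 1" for z
    using w by (auto simp: f_def h_def norm_power power_le_one)
  have "r \<le> (\<integral>z. indicator (- {z. fst z < snd z}) z \<partial>P)"
    unfolding r_def
    by (intro integral_mono measure_pmf.integrable_const_bound[where B=1])
      (auto simp: f1, auto simp: f_def indicator_def norm_power power_le_one w)
  also have "\<dots> = 1 - measure_pmf.prob P {z. fst z < snd z}"
    by (simp add: measure_pmf.prob_compl[of "{z. fst z < snd z}" P, simplified] Compl_eq_Diff_UNIV)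
  finally have r1: "r < 1" using succ by simp
  have r0: "0 \<le> r" by (simp add: r_def)
  have B: "B = (\<integral>z. f z \<partial>P)" and A: "A = (\<integral>z. h z \<partial>P)"
    by (simp_all add: A_def B_def f_def h_def)
  have "norm B \<le> r"
    unfolding B r_def by (rule integral_norm_bound)
  then show B1: "norm B < 1" using r1 by simp
  define G where "G i \<omega> = (\<Prod>j<i. f (Y j \<omega>)) * h (Y i \<omega>)" for i \<omega>
  have ex: "\<exists>N. (\<forall>i. i \<noteq> N \<longrightarrow> G i \<omega> = 0) \<and>
      enat_power w (completion_time (\<lambda>i. fst (Y i \<omega>)) (\<lambda>i. snd (Y i \<omega>))) = G N \<omega>" for \<omega>
    unfolding G_def f_def h_def
    by (rule enat_power_completion_time[of "\<lambda>i. fst (Y i \<omega>)" "\<lambda>i. snd (Y i \<omega>)" w]) blast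
  have sums: "(\<lambda>i. G i \<omega>) sums enat_power w (completion_time (\<lambda>i. fst (Y i \<omega>)) (\<lambda>i. snd (Y i \<omega>)))"
    and abs: "summable (\<lambda>i. norm (G i \<omega>))" for \<omega>
  proof -
    obtain N where N: "\<And>i. i \<noteq> N \<Longrightarrow> G i \<omega> = 0"
      "enat_power w (completion_time (\<lambda>i. fst (Y i \<omega>)) (\<lambda>i. snd (Y i \<omega>))) = G N \<omega>"
      using ex by blast
    show "(\<lambda>i. G i \<omega>) sums enat_power w (completion_time (\<lambda>i. fst (Y i \<omega>)) (\<lambda>i. snd (Y i \<omega>)))"
      using sums_finite[of "{N}" "\<lambda>i. G i \<omega>"] N by simp
    show "summable (\<lambda>i. norm (G i \<omega>))"
      by (rule summable_finite[of "{N}"]) (auto simp: N)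
  qed
  have int: "integrable M (G i)" for i
    using indep_vars_integral_geometric(1)[where f=f and h=h, OF indep law f1 h1] by (simp add: G_def[abs_def])
  have int_norm: "(\<integral>\<omega>. norm (G i \<omega>) \<partial>M) = r ^ i * (\<integral>z. norm (h z) \<partial>P)" for i
    using indep_vars_integral_geometric(2)[OF indep law, of "\<lambda>z. norm (f z)" "\<lambda>z. norm (h z)" i]
    by (simp add: G_def norm_mult prod_norm r_def f1 h1)
  \<comment> \<open>Sum and integral may be exchanged because the integrated norms form a geometric
    series with ratio \<open>r < 1\<close>.\<close>
  have "(\<lambda>i. \<integral>\<omega>. G i \<omega> \<partial>M) sums (\<integral>\<omega>. (\<Sum>i. G i \<omega>) \<partial>M)"
    using r0 r1 by (intro sums_integral int) (auto simp: abs int_norm intro!: summable_mult2 summable_geometric)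
  also have "(\<lambda>i. \<integral>\<omega>. G i \<omega> \<partial>M) = (\<lambda>i. B ^ i * A)"
    using indep_vars_integral_geometric(2)[where f=f and h=h, OF indep law f1 h1] by (simp add: G_def A B)
  finally have "(\<lambda>i. B ^ i * A) sums
      pgf M (\<lambda>\<omega>. completion_time (\<lambda>i. fst (Y i \<omega>)) (\<lambda>i. snd (Y i \<omega>))) w"
    by (simp add: pgf_def sums_unique[OF sums, symmetric])
  moreover have "(\<lambda>i. B ^ i * A) sums (1 / (1 - B) * A)"
    by (intro sums_mult2 geometric_sums B1)
  ultimately show "pgf M (\<lambda>\<omega>. completion_time (\<lambda>i. fst (Y i \<omega>)) (\<lambda>i. snd (Y i \<omega>))) w = A / (1 - B)"
    using sums_unique2 by fastforce
qed

section \<open>The law of one memoryless attempt\<close>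

text \<open>This is the factor of the product space in \<open>memoryless_law\<close>, named so that
  arbitrary probability spaces and the canonical one can be treated together.\<close>

definition attempt_pmf :: "real \<Rightarrow> nat pmf \<Rightarrow> (nat \<times> nat) pmf" where
  "attempt_pmf q p = pair_pmf p (map_pmf Suc (geometric_pmf q))"

lemma base_pgf_altdef: "base_pgf p w = (\<integral>x. w ^ x \<partial>p)"
  by (simp add: base_pgf_def pgf_def enat_power_def)

context
  fixes q s :: real
  assumes q: "0 < q" "q < 1" and s: "s = 1 - q"
begin

lemma prob_geometric_tail: "measure_pmf.prob (map_pmf Suc (geometric_pmf q)) {x<..} = s ^ x"
proof -
  have *: "measure_pmf.prob (geometric_pmf q) {..<x} = 1 - s ^ x"
    using q by (subst measure_measure_pmf_finite)
      (auto simp: s one_diff_power_eq[of "1 - q"] sum_distrib_left mult.commute)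
  \<comment> \<open>The shift by one turns the strict tail beyond \<open>x\<close> into the
    complement of the first \<open>x\<close> values, whose mass is a finite geometric sum.\<close>
  have "Suc -` {x<..} = UNIV - {..<x}" by auto
  then show ?thesis
    using measure_pmf.prob_compl[of "{..<x}" "geometric_pmf q"] * by simp
qed

text \<open>Tails determine a law on the naturals: 0 is the complement of the tail beyond 0, and any
  other singleton is a difference of consecutive tails. The locale specifies the catastrophe time
  only through its tails.\<close>

lemma distr_eq_geometric:
  assumes "prob_space M" and \<tau>[measurable]: "\<tau> \<in> M \<rightarrow>\<^sub>M count_space UNIV"
    and tail: "\<And>t. measure M {\<omega> \<in> space M. t < \<tau> \<omega>} = s ^ t"
  shows "distr M (count_space UNIV) \<tau> = measure_pmf (map_pmf Suc (geometric_pmf q))"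
proof (rule measure_eqI_countable)
  interpret prob_space M by fact
  interpret D: prob_space "distr M (count_space UNIV) \<tau>"
    by (rule prob_space_distr) simp
  have tail': "measure (distr M (count_space UNIV) \<tau>) {t<..} = s ^ t" for t
    by (subst measure_distr) (auto simp flip: tail intro!: arg_cong[where f="measure M"])
  show "emeasure (distr M (count_space UNIV) \<tau>) {k} =
      emeasure (measure_pmf (map_pmf Suc (geometric_pmf q))) {k}" for k
  proof (cases k)
    case 0
    have "{k} = UNIV - {0<..}" using 0 by auto
    then show ?thesis
      using D.prob_compl[of "{0<..}"] tail'[of 0]
        measure_pmf.prob_compl[of "{0<..}" "map_pmf Suc (geometric_pmf q)"] prob_geometric_tail[of 0]
      by (simp add: D.emeasure_eq_measure measure_pmf.emeasure_eq_measure)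
  next
    case (Suc m)
    have "{k} = {m<..} - {k<..}" "{k<..} \<subseteq> {m<..}" using Suc by auto
    then show ?thesis
      by (simp add: D.emeasure_eq_measure measure_pmf.emeasure_eq_measure D.finite_measure_Diff
          measure_pmf.finite_measure_Diff tail' prob_geometric_tail del: measure_map_pmf)
  qed
qed auto

text \<open>For a fixed base time \<open>x\<close>, success contributes \<open>w ^ x\<close> times
  the tail \<open>s ^ x\<close>, and failure contributes a finite geometric sum. The factor
  \<open>1 - w * s\<close> sums the latter without division.\<close>

lemma
  fixes w :: complex
  shows integral_geometric_greater:
      "(\<integral>t. (if x < t then w ^ x else 0) \<partial>map_pmf Suc (geometric_pmf q)) = (w * of_real s) ^ x"
    and integral_geometric_le:
      "(1 - w * of_real s) * (\<integral>t. (if x < t then 0 else w ^ t) \<partial>map_pmf Suc (geometric_pmf q)) =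
         of_real q * w * (1 - (w * of_real s) ^ x)"
proof -
  have "(\<integral>t. (if x < t then w ^ x else 0) \<partial>map_pmf Suc (geometric_pmf q)) =
      (\<integral>t. indicator {x<..} t *\<^sub>R w ^ x \<partial>map_pmf Suc (geometric_pmf q))"
    by (intro Bochner_Integration.integral_cong) auto
  also have "\<dots> = measure_pmf.prob (map_pmf Suc (geometric_pmf q)) {x<..} *\<^sub>R w ^ x"
    using measure_pmf.integrable_const_bound[where f="indicator {x<..} :: nat \<Rightarrow> real" and B=1]
    by (subst integral_scaleR_left) (simp_all del: integral_map_pmf measure_map_pmf)
  finally show "(\<integral>t. (if x < t then w ^ x else 0) \<partial>map_pmf Suc (geometric_pmf q)) = (w * of_real s) ^ x"
    by (simp only: prob_geometric_tail) (simp add: scaleR_conv_of_real power_mult_distrib)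
  \<comment> \<open>Failure means \<open>t <= x\<close>, the tie included; with
    \<open>t = Suc n\<close> this leaves exactly \<open>n < x\<close>, each with mass
    \<open>q * s ^ n\<close>.\<close>
  have "(\<integral>t. (if x < t then 0 else w ^ t) \<partial>map_pmf Suc (geometric_pmf q)) =
      (\<Sum>n<x. pmf (geometric_pmf q) n *\<^sub>R w ^ Suc n)"
    unfolding integral_map_pmf
    by (subst integral_measure_pmf[where A="{..<x}"]) (auto intro!: sum.cong split: if_splits)
  also have "\<dots> = of_real q * w * (\<Sum>n<x. (w * of_real s) ^ n)"
    using q by (simp add: s scaleR_conv_of_real sum_distrib_left power_mult_distrib mult_ac)
  finally show "(1 - w * of_real s) * (\<integral>t. (if x < t then 0 else w ^ t) \<partial>map_pmf Suc (geometric_pmf q)) =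
         of_real q * w * (1 - (w * of_real s) ^ x)"
    using one_diff_power_eq[of "w * of_real s" x] by simp
qed

lemma norm_mult_s_less_1:
  fixes w :: complex
  assumes "norm w \<le> 1"
  shows "norm (w * of_real s) < 1"
proof -
  have "norm (w * of_real s) \<le> 1 * \<bar>s\<bar>"
    using assms unfolding norm_mult norm_of_real by (rule mult_right_mono) simp
  also have "\<dots> < 1"
    using q by (simp add: s)
  finally show ?thesis .
qed

text \<open>By Fubini, the fixed-\<open>x\<close> formulas are averaged over the base time, and
  averaging \<open>(w * s) ^ x\<close> produces \<open>base_pgf\<close> at
  \<open>w * s\<close>.\<close>

lemma
  fixes w :: complex
  assumes w: "norm w \<le> 1"
  shows integral_attempt_success:
      "(\<integral>z. (if fst z < snd z then w ^ fst z else 0) \<partial>attempt_pmf q p) = base_pgf p (w * of_real s)"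
    and integral_attempt_failure:
      "(1 - w * of_real s) * (\<integral>z. (if fst z < snd z then 0 else w ^ snd z) \<partial>attempt_pmf q p) =
         of_real q * w * (1 - base_pgf p (w * of_real s))"
proof -
  have int: "integrable (measure_pmf p) (\<lambda>x. (w * of_real s) ^ x)"
    using norm_mult_s_less_1[OF w]
    by (intro measure_pmf.integrable_const_bound[where B=1])
      (auto simp: norm_power intro!: power_le_one)
  show "(\<integral>z. (if fst z < snd z then w ^ fst z else 0) \<partial>attempt_pmf q p) = base_pgf p (w * of_real s)"
    unfolding attempt_pmf_def
    by (subst integral_pair_pmf)
      (auto simp: integral_geometric_greater base_pgf_altdef norm_power power_le_one w
         simp del: integral_map_pmf cong: if_cong
         intro!: measure_pmf.integrable_const_bound[where B=1])
  have "(1 - w * of_real s) * (\<integral>z. (if fst z < snd z then 0 else w ^ snd z) \<partial>attempt_pmf q p) =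
      (\<integral>x. (1 - w * of_real s) * (\<integral>t. (if x < t then 0 else w ^ t) \<partial>map_pmf Suc (geometric_pmf q)) \<partial>p)"
    unfolding attempt_pmf_def
    by (subst integral_pair_pmf)
      (auto simp: norm_power power_le_one w
         simp del: integral_map_pmf cong: if_cong
         intro!: measure_pmf.integrable_const_bound[where B=1])
  also have "\<dots> = of_real q * w * (1 - base_pgf p (w * of_real s))"
    using int by (simp add: integral_geometric_le base_pgf_altdef del: integral_map_pmf)
  finally show "(1 - w * of_real s) * (\<integral>z. (if fst z < snd z then 0 else w ^ snd z) \<partial>attempt_pmf q p) =
      of_real q * w * (1 - base_pgf p (w * of_real s))" .
qed

lemma prob_attempt_success_pos: "measure_pmf.prob (attempt_pmf q p) {z. fst z < snd z} > 0"
proof -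
  obtain x where x: "x \<in> set_pmf p" using set_pmf_not_empty by fast
  \<comment> \<open>The shifted geometric law charges every positive integer, so a catastrophe just
    after any possible base time \<open>x\<close> has positive probability.\<close>
  have "(x, Suc x) \<in> set_pmf (attempt_pmf q p)"
    using x q by (auto simp: attempt_pmf_def set_pmf_geometric)
  then show ?thesis
    by (intro measure_pmf_posI[of "(x, Suc x)"]) auto
qed

section \<open>The closed form of the generating function\<close>

text \<open>The denominator factors as \<open>(1 - w * s) * (1 - B)\<close>. Neither factor vanishes
  on the closed unit disc, since \<open>w * s\<close> and \<open>B\<close> both have norm below 1;
  cancelling \<open>1 - w * s\<close> gives the quotient \<open>A / (1 - B)\<close>.\<close>

lemma pgf_memoryless:
  fixes M :: "'a measure" and Y :: "nat \<Rightarrow> 'a \<Rightarrow> nat \<times> nat" and w :: complex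
  assumes prob: "prob_space M"
    and indep: "prob_space.indep_vars M (\<lambda>_. count_space UNIV) Y UNIV"
    and law: "\<And>i. distr M (count_space UNIV) (Y i) = measure_pmf (attempt_pmf q p)"
    and w: "norm w \<le> 1"
  shows "of_real q * w * base_pgf p (w * of_real s) + (1 - w) \<noteq> 0"
    and "pgf M (\<lambda>\<omega>. completion_time (\<lambda>i. fst (Y i \<omega>)) (\<lambda>i. snd (Y i \<omega>))) w =
      (1 - w * of_real s) * base_pgf p (w * of_real s) /
        (of_real q * w * base_pgf p (w * of_real s) + (1 - w))"
proof -
  interpret prob_space M by fact
  define B where "B = (\<integral>z. (if fst z < snd z then 0 else w ^ snd z) \<partial>attempt_pmf q p)"
  note main = pgf_completion_time[OF indep law w prob_attempt_success_pos,
      folded B_def, unfolded integral_attempt_success[OF w]]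
  have ws: "1 - w * of_real s \<noteq> 0"
    using norm_mult_s_less_1[OF w] by auto
  have "1 - B \<noteq> 0" using main(1) by auto
  have "(1 - w * of_real s) * (1 - B) =
      (1 - w * of_real s) - of_real q * w * (1 - base_pgf p (w * of_real s))"
    using integral_attempt_failure[OF w, of p] by (simp add: B_def right_diff_distrib)
  \<comment> \<open>Here \<open>s + q = 1\<close> collapses \<open>1 - w * s - q * w\<close> to
    \<open>1 - w\<close>.\<close>
  also have "\<dots> = of_real q * w * base_pgf p (w * of_real s) + (1 - w)"
    by (simp add: s algebra_simps)
  finally have eq: "of_real q * w * base_pgf p (w * of_real s) + (1 - w) =
      (1 - w * of_real s) * (1 - B)" ..
  show "of_real q * w * base_pgf p (w * of_real s) + (1 - w) \<noteq> 0"
    unfolding eq using ws \<open>1 - B \<noteq> 0\<close> by simp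
  show "pgf M (\<lambda>\<omega>. completion_time (\<lambda>i. fst (Y i \<omega>)) (\<lambda>i. snd (Y i \<omega>))) w =
      (1 - w * of_real s) * base_pgf p (w * of_real s) /
        (of_real q * w * base_pgf p (w * of_real s) + (1 - w))"
    unfolding eq main(2) using ws by simp
qed

text \<open>The tails fix the law of \<open>\<tau> i\<close>, and independence within the attempt
  makes the joint law the product of the marginals.\<close>

lemma distr_attempt:
  assumes "memoryless_catastrophe M q p X \<tau>"
  shows "distr M (count_space UNIV) (\<lambda>\<omega>. (X i \<omega>, \<tau> i \<omega>)) = measure_pmf (attempt_pmf q p)"
proof -
  interpret memoryless_catastrophe M q p X \<tau> by fact
  have \<tau>: "distr M (count_space UNIV) (\<tau> i) = measure_pmf (map_pmf Suc (geometric_pmf q))"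
    by (intro distr_eq_geometric prob_space_axioms \<tau>_measurable) (simp add: \<tau>_tail s)
  have "measure_pmf (attempt_pmf q p) = distr M (count_space UNIV \<Otimes>\<^sub>M count_space UNIV) (\<lambda>\<omega>. (X i \<omega>, \<tau> i \<omega>))"
    using X_\<tau>_indep[of i]
    by (simp add: indep_var_distribution_eq X_law \<tau> pair_measure_pmf attempt_pmf_def)
  then show ?thesis
    by (simp add: pair_measure_countable)
qed

lemma pgf_memoryless_law:
  fixes w :: complex
  assumes w: "norm w \<le> 1"
  shows "of_real q * w * base_pgf p (w * of_real s) + (1 - w) \<noteq> 0" (is ?nz)
    and "pgf (memoryless_law q p) (\<lambda>n. n) w =
      (1 - w * of_real s) * base_pgf p (w * of_real s) /
        (of_real q * w * base_pgf p (w * of_real s) + (1 - w))" (is ?eq)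
proof -
  define M where "M = (\<Pi>\<^sub>M i\<in>(UNIV :: nat set). measure_pmf (attempt_pmf q p))"
  define Y :: "nat \<Rightarrow> (nat \<Rightarrow> nat \<times> nat) \<Rightarrow> nat \<times> nat" where "Y i \<omega> = \<omega> i" for i \<omega>
  interpret prob_space M
    unfolding M_def by (intro prob_space_PiM) unfold_locales
  have rv[measurable]: "Y i \<in> M \<rightarrow>\<^sub>M count_space UNIV" for i
  proof -
    have "(\<lambda>\<omega>. \<omega> i) \<in> M \<rightarrow>\<^sub>M measure_pmf (attempt_pmf q p)"
      unfolding M_def by (rule measurable_component_singleton) simp
    then show ?thesis by (simp add: Y_def[abs_def])
  qed
  have law: "distr M (count_space UNIV) (Y i) = measure_pmf (attempt_pmf q p)" for i
  proof -
    have "distr M (measure_pmf (attempt_pmf q p)) (\<lambda>\<omega>. \<omega> i) = measure_pmf (attempt_pmf q p)"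
      unfolding M_def by (rule distr_PiM_component) (auto intro: measure_pmf.prob_space_axioms)
    moreover have "distr M (count_space UNIV) (Y i) = distr M (measure_pmf (attempt_pmf q p)) (\<lambda>\<omega>. \<omega> i)"
      by (intro distr_cong) (auto simp: Y_def)
    ultimately show ?thesis by simp
  qed
  \<comment> \<open>The coordinates jointly form the identity map, so their joint law is
    \<open>M\<close> itself, the product of their marginals; this is the criterion for
    independence.\<close>
  have "distr M (\<Pi>\<^sub>M i\<in>UNIV. count_space UNIV) (\<lambda>\<omega>. \<lambda>i\<in>UNIV. Y i \<omega>) = distr M M (\<lambda>\<omega>. \<omega>)"
    by (intro distr_cong) (auto simp: M_def Y_def intro!: sets_PiM_cong)
  then have "indep_vars (\<lambda>_. count_space UNIV) Y UNIV"
    by (subst indep_vars_iff_distr_eq_PiM') (auto simp: law distr_id2 M_def[symmetric])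
  note main = pgf_memoryless[OF prob_space_axioms this law w]
  show ?nz by (rule main)
  have "memoryless_law q p =
      distr M (count_space UNIV) (\<lambda>\<omega>. completion_time (\<lambda>i. fst (Y i \<omega>)) (\<lambda>i. snd (Y i \<omega>)))"
    by (simp add: memoryless_law_def M_def Y_def attempt_pmf_def)
  then have "pgf (memoryless_law q p) (\<lambda>n. n) w =
      pgf M (\<lambda>\<omega>. completion_time (\<lambda>i. fst (Y i \<omega>)) (\<lambda>i. snd (Y i \<omega>))) w"
    unfolding pgf_def by (simp add: integral_distr)
  then show ?eq using main(2) by simp
qed

text \<open>At \<open>w = 1\<close> numerator and denominator are both
  \<open>q * base_pgf p s\<close>, which is nonzero. As infinite times contribute 0, this expresses
  almost sure completion.\<close>

lemma pgf_memoryless_law_1: "pgf (memoryless_law q p) (\<lambda>n. n) 1 = 1"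
  using pgf_memoryless_law[of 1 p] by (simp add: s)

section \<open>Uniform affine structure and normalization\<close>

lemma uniform_affine_pgf_memoryless_law:
  "uniform_affine_pgf (memoryless_law q) (\<lambda>w. 1 - w * of_real s) (\<lambda>w. 0)
     (\<lambda>w. of_real q * w) (\<lambda>w. 1 - w) (\<lambda>w. w * of_real s)"
  unfolding uniform_affine_pgf_def
proof (intro conjI allI impI)
  \<comment> \<open>A property holding eventually in \<open>nhds 1\<close> holds at 1 itself, where
    this coefficient and the next one both equal \<open>q\<close>.\<close>
  show "\<not> (\<forall>\<^sub>F w in nhds 1. 1 - w * complex_of_real s = 0)"
    using q by (auto dest!: eventually_nhds_x_imp_x simp: s)
  show "\<not> (\<forall>\<^sub>F w in nhds 1. complex_of_real q * w = 0)"
    using q by (auto dest!: eventually_nhds_x_imp_x)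
  show "\<exists>r. 0 < r \<and> r < 1 \<and> (\<forall>w. w * complex_of_real s = of_real r * w)"
    using q by (intro exI[of _ s]) (auto simp: s)
  show "complex_of_real q * 1 * base_pgf p (1 * of_real s) + (1 - 1) \<noteq> 0" for p
    by (rule pgf_memoryless_law(1)) simp
  show "\<forall>\<^sub>F w in nhds 1. norm w \<le> 1 \<longrightarrow> pgf (memoryless_law q p) (\<lambda>n. n) w =
      ((1 - w * of_real s) * base_pgf p (w * of_real s) + 0) /
        (of_real q * w * base_pgf p (w * of_real s) + (1 - w))" for p
    using pgf_memoryless_law(2)[of _ p] by (intro always_eventually) simp
qed (auto intro!: analytic_intros)

text \<open>Evaluating the representation at 1 for one concrete base time, the constant 1, gives
  \<open>1 = a 1 * g / (c 1 * g)\<close> with nonzero denominator, so \<open>g\<close>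
  cancels.\<close>

lemma uniform_affine_pgf_memoryless_law_at_1:
  assumes "uniform_affine_pgf (memoryless_law q) a b c d u" and "b 1 = 0" "d 1 = 0"
  shows "a 1 = c 1"
proof -
  have "base_time (return_pmf 1)" by (simp add: base_time_def)
  with assms(1) have "c 1 * base_pgf (return_pmf 1) (u 1) + d 1 \<noteq> 0"
    and "\<forall>\<^sub>F w in nhds 1. norm w \<le> 1 \<longrightarrow> pgf (memoryless_law q (return_pmf 1)) (\<lambda>n. n) w =
      (a w * base_pgf (return_pmf 1) (u w) + b w) / (c w * base_pgf (return_pmf 1) (u w) + d w)"
    unfolding uniform_affine_pgf_def by blast+
  from this(1) eventually_nhds_x_imp_x[OF this(2)] show ?thesis
    using assms(2,3) by (simp add: pgf_memoryless_law_1)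
qed

end

text \<open>The formula is obtained for every realization of the process, while the uniform
  structure concerns the canonical law. That normalization forces \<open>a 1 = c 1\<close> is
  expressed by quantifying over all affine representations with \<open>b' 1 = d' 1 = 0\<close>; the
  common value \<open>q\<close> comes from the explicit coefficients.\<close>

theorem proposition2p5:
  fixes q s :: real and a b c d u :: "complex \<Rightarrow> complex"
  assumes q: "0 < q" "q < 1" and s: "s = 1 - q"
    and a: "a = (\<lambda>w. 1 - w * of_real s)"
    and b: "b = (\<lambda>w. 0)"
    and c: "c = (\<lambda>w. of_real q * w)"
    and d: "d = (\<lambda>w. 1 - w)"
    and u: "u = (\<lambda>w. w * of_real s)"
  shows
    "(\<forall>(M :: 'a measure) p X \<tau>. memoryless_catastrophe M q p X \<tau> \<longrightarrow>
        (\<forall>w. norm w \<le> 1 \<longrightarrow>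
           c w * base_pgf p (u w) + d w \<noteq> 0 \<and>
           pgf M (\<lambda>\<omega>. completion_time (\<lambda>i. X i \<omega>) (\<lambda>i. \<tau> i \<omega>)) w =
             (a w * base_pgf p (u w) + b w) / (c w * base_pgf p (u w) + d w))) \<and>
     uniform_affine_pgf (memoryless_law q) a b c d u \<and>
     b 1 = 0 \<and> d 1 = 0 \<and>
     (\<forall>p. base_time p \<longrightarrow> pgf (memoryless_law q p) (\<lambda>n. n) 1 = 1) \<and>
     (\<forall>a' b' c' d' u'. uniform_affine_pgf (memoryless_law q) a' b' c' d' u' \<longrightarrow>
        b' 1 = 0 \<longrightarrow> d' 1 = 0 \<longrightarrow> a' 1 = c' 1) \<and>
     a 1 = of_real q \<and> c 1 = of_real q"
proof (intro conjI allI impI)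
  note qs = q s
  fix M :: "'a measure" and p X \<tau> and w :: complex
  assume cat: "memoryless_catastrophe M q p X \<tau>" and w: "norm w \<le> 1"
  interpret memoryless_catastrophe M q p X \<tau> by fact
  note main = pgf_memoryless[OF qs prob_space_axioms attempts_indep distr_attempt[OF qs cat] w]
  show "c w * base_pgf p (u w) + d w \<noteq> 0"
    using main(1) by (simp add: c d u)
  show "pgf M (\<lambda>\<omega>. completion_time (\<lambda>i. X i \<omega>) (\<lambda>i. \<tau> i \<omega>)) w =
      (a w * base_pgf p (u w) + b w) / (c w * base_pgf p (u w) + d w)"
    using main(2) by (simp add: a b c d u)
next
  show "uniform_affine_pgf (memoryless_law q) a b c d u"
    unfolding a b c d u by (rule uniform_affine_pgf_memoryless_law[OF q s])
  show "pgf (memoryless_law q p) (\<lambda>n. n) 1 = 1" for p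
    by (rule pgf_memoryless_law_1[OF q s])
  show "a' 1 = c' 1"
    if "uniform_affine_pgf (memoryless_law q) a' b' c' d' u'" "b' 1 = 0" "d' 1 = 0" for a' b' c' d' u'
    using uniform_affine_pgf_memoryless_law_at_1[OF q s that] .
qed (auto simp: a b c d s)

end
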